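(* Let $(E,e,T)$ be a conditional Riesz triple and $(y_n)$ a sequence of natural elements in $E$. Assume that $y_n$ has a Binomial $T$-distribution $\mathcal B(n,p_n)$ such that $np_n\overset{o}{\longrightarrow}g$ for some $g\in E_e^+$ with $g>0$. Then $(y_n)$ converges in $T$-distribution to $\mathcal P(g)$, that is, $$TP_{y_n=ke}e\overset{o}{\longrightarrow}\frac1{k!}g^k\exp(-g)\quad (n\to\infty)$$ for all integers $k\ge0$.
   Context: A conditional Riesz triple $(E,e,T)$ consists of a Dedekind complete Riesz space $E$ with weak order unit $e$ and a conditional expectation operator $T$ on $E$, i.e. a positive order continuous projection with $Te=e$ whose range $R(T)$ is a Dedekind complete Riesz subspace; $T$ is also assumed strictly positive ($f>0\Rightarrow Tf>0$). $E_e$ is the order ideal generated by $e$. The universal completion $E^u$ of $E$ is an $f$-algebra with multiplicative unit $e$; products are taken there, and $\exp$ is defined by functional calculus (for $x\ge0$, $\exp(x)=\sup_n\sum_{k=0}^n x^k/k!$; $\exp(x)\exp(-x)=e$). $P_z$ is the band projection onto the band generated by $z$, $P^d=I-P$, and $P_{x=y}=P^d_{|x-y|}$. The $T$-mass function of $x\in E$ is $\pi_x(t)=TP_{x=te}e$; $x$ is natural if $\sum_{n=0}^\infty\pi_x(n)=e$. For $n\in\mathbb N$ and $p\in E$ with $0<p<e$, $x$ has Binomial $T$-distribution $\mathcal B(n,p)$ if $\pi_x(k)=\binom nk p^k(e-p)^{n-k}$ for $k=0,\dots,n$. $\mathcal P(g)$ is the Poisson distribution with mass function $k\mapsto \frac{g^k}{k!}\exp(-g)$,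 $k=0,1,2,\dots$. $\overset{o}{\longrightarrow}$ is order convergence. *)

theory Defs
  imports "HOL-Analysis.Analysis" "HOL-Library.Lattice_Algebras"
begin

class riesz_space = lattice_ab_group_add_abs + ordered_real_vector

class dedekind_complete_riesz_space = riesz_space + conditionally_complete_lattice

definition disjoint_elts :: "'a::riesz_space \<Rightarrow> 'a \<Rightarrow> bool" where
  "disjoint_elts x y \<longleftrightarrow> inf \<bar>x\<bar> \<bar>y\<bar> = 0"

definition order_ideal :: "'a::riesz_space set \<Rightarrow> bool" where
  "order_ideal I \<longleftrightarrow> subspace I \<and> (\<forall>y\<in>I. \<forall>x. \<bar>x\<bar> \<le> \<bar>y\<bar> \<longrightarrow> x \<in> I)"

definition band :: "'a::dedekind_complete_riesz_space set \<Rightarrow> bool" where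
  "band B \<longleftrightarrow> order_ideal B \<and> (\<forall>A\<subseteq>B. A \<noteq> {} \<and> bdd_above A \<longrightarrow> Sup A \<in> B)"

(* The projection along the decomposition of the space into B and its disjoint complement. *)
definition band_projection ::
  "'a::dedekind_complete_riesz_space set \<Rightarrow> 'a \<Rightarrow> 'a" where
  "band_projection B x = (THE u. u \<in> B \<and> (\<forall>b\<in>B. disjoint_elts (x - u) b))"

definition proj :: "'a::dedekind_complete_riesz_space \<Rightarrow> 'a \<Rightarrow> 'a" where
  "proj z = band_projection (band hull {z})"

definition proj_eq :: "'a::dedekind_complete_riesz_space \<Rightarrow> 'a \<Rightarrow> 'a \<Rightarrow> 'a" where
  "proj_eq x y f = f - proj \<bar>x - y\<bar> f"

definition weak_order_unit :: "'a::dedekind_complete_riesz_space \<Rightarrow> bool" where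
  "weak_order_unit e \<longleftrightarrow> 0 \<le> e \<and> band hull {e} = UNIV"

(* The inequalities force 0 \<le> u n, so the infimum below is a genuine one. *)
definition order_converges ::
  "(nat \<Rightarrow> 'a::dedekind_complete_riesz_space) \<Rightarrow> 'a \<Rightarrow> bool" where
  "order_converges x l \<longleftrightarrow>
    (\<exists>u. decseq u \<and> (INF n. u n) = 0 \<and> (\<forall>n. \<bar>x n - l\<bar> \<le> u n))"

definition positive_operator :: "('a::riesz_space \<Rightarrow> 'a) \<Rightarrow> bool" where
  "positive_operator T \<longleftrightarrow> linear T \<and> (\<forall>x\<ge>0. 0 \<le> T x)"

(* For positive operators; a net decreasing to 0 is represented by its range, a downward
   directed set with infimum 0. *)
definition order_continuous_operator ::
  "('a::dedekind_complete_riesz_space \<Rightarrow> 'a) \<Rightarrow> bool" where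
  "order_continuous_operator T \<longleftrightarrow>
    (\<forall>D. D \<noteq> {} \<and> (\<forall>a\<in>D. \<forall>b\<in>D. \<exists>c\<in>D. c \<le> a \<and> c \<le> b) \<and> bdd_below D \<and> Inf D = 0
      \<longrightarrow> Inf (T ` D) = 0)"

definition riesz_subspace :: "'a::riesz_space set \<Rightarrow> bool" where
  "riesz_subspace R \<longleftrightarrow> subspace R \<and> (\<forall>x\<in>R. \<forall>y\<in>R. sup x y \<in> R \<and> inf x y \<in> R)"

(* Completeness of R as a Riesz space in its own right: suprema are taken within R. *)
definition dedekind_complete_subspace :: "'a::riesz_space set \<Rightarrow> bool" where
  "dedekind_complete_subspace R \<longleftrightarrow> riesz_subspace R \<and>
    (\<forall>A\<subseteq>R. A \<noteq> {} \<and> (\<exists>b\<in>R. \<forall>a\<in>A. a \<le> b)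
      \<longrightarrow> (\<exists>s\<in>R. (\<forall>a\<in>A. a \<le> s) \<and> (\<forall>b\<in>R. (\<forall>a\<in>A. a \<le> b) \<longrightarrow> s \<le> b)))"

locale conditional_riesz_triple =
  fixes e :: "'a::dedekind_complete_riesz_space"
    and T :: "'a \<Rightarrow> 'a"
  assumes weak_unit: "weak_order_unit e"
    and positive: "positive_operator T"
    and order_continuous: "order_continuous_operator T"
    and projection: "T (T x) = T x"
    and T_unit: "T e = e"
    and range_complete: "dedekind_complete_subspace (range T)"
    and strictly_positive: "0 < f \<Longrightarrow> 0 < T f"

definition T_mass ::
  "'a::dedekind_complete_riesz_space \<Rightarrow> ('a \<Rightarrow> 'a) \<Rightarrow> 'a \<Rightarrow> real \<Rightarrow> 'a" where
  "T_mass e T x t = T (proj_eq x (t *\<^sub>R e) e)"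

definition natural_element ::
  "'a::dedekind_complete_riesz_space \<Rightarrow> ('a \<Rightarrow> 'a) \<Rightarrow> 'a \<Rightarrow> bool" where
  "natural_element e T x \<longleftrightarrow> order_converges (\<lambda>N. \<Sum>n<N. T_mass e T x (real n)) e"

(* Commutativity is automatic for Archimedean f-algebras. *)
class unital_f_algebra = riesz_space + lattice_ring + real_algebra_1 + comm_ring_1 +
  assumes f_algebra_inf: "inf a b = 0 \<Longrightarrow> 0 \<le> c \<Longrightarrow> inf (c * a) b = 0"

class universally_complete_f_algebra = unital_f_algebra + dedekind_complete_riesz_space +
  assumes laterally_complete:
    "(\<And>a. a \<in> A \<Longrightarrow> 0 \<le> a) \<Longrightarrow> pairwise (\<lambda>a b. inf a b = 0) A \<Longrightarrow> bdd_above A"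

(* A space and its universal completion are two different types, so the inclusion is an
   explicit map j.  The universal completion is determined up to Riesz isomorphism by j being
   an embedding onto an order dense Riesz subspace of a universally complete Riesz space, and
   its multiplication is determined by its unit 1 = j e. *)
locale universal_completion =
  fixes e :: "'a::dedekind_complete_riesz_space"
    and j :: "'a \<Rightarrow> 'u::universally_complete_f_algebra"
  assumes j_linear: "linear j"
    and j_inj: "inj j"
    and j_sup: "j (sup x y) = sup (j x) (j y)"
    and j_inf: "j (inf x y) = inf (j x) (j y)"
    and j_order_dense: "0 < u \<Longrightarrow> \<exists>x. 0 < j x \<and> j x \<le> u"
    and j_unit: "j e = 1"

definition exp_nonneg :: "'u::universally_complete_f_algebra \<Rightarrow> 'u" where
  "exp_nonneg x = (SUP n. \<Sum>k\<le>n. (1 / fact k) *\<^sub>R x ^ k)"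

(* exp x = exp (x^+) * exp (- x^-), the second factor being the inverse of exp (x^-);
   note that nprt x = - x^-. *)
definition riesz_exp :: "'u::universally_complete_f_algebra \<Rightarrow> 'u" where
  "riesz_exp x = exp_nonneg (pprt x) * (THE v. exp_nonneg (- nprt x) * v = 1)"

(* The product is formed in the universal completion, hence the equation is stated there. *)
definition binomial_T_distribution ::
  "'a::dedekind_complete_riesz_space \<Rightarrow> ('a \<Rightarrow> 'a) \<Rightarrow>
    ('a \<Rightarrow> 'u::universally_complete_f_algebra) \<Rightarrow> 'a \<Rightarrow> nat \<Rightarrow> 'a \<Rightarrow> bool" where
  "binomial_T_distribution e T j x n p \<longleftrightarrow> 0 < p \<and> p < e \<and>
    (\<forall>k\<le>n. j (T_mass e T x (real k)) =
       real (n choose k) *\<^sub>R (j p ^ k * j (e - p) ^ (n - k)))"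

end

theory Submission
  imports Defs
begin

text \<open>The \<open>T\<close>-mass of \<open>y\<^sub>n\<close> at \<open>k \<le> n\<close> is, in the universal completion, the binomial weight
\<open>(n choose k) q\<^sup>k (1 - q)\<^bsup>n-k\<^esup>\<close> with \<open>q = j p\<^sub>n\<close>.  The theorem is therefore the classical Poisson
limit, carried out in the f-algebra and then pulled back along the embedding \<open>j\<close>.

Order convergence is used throughout in the form
\<open>order_converges_iff_eventual_bounds\<close>: the infimum of all eventual upper bounds of
\<open>\<bar>x\<^sub>n - l\<bar>\<close> is \<open>0\<close>.  This makes limits insensitive to finitely many terms, and sums, products
and comparisons need only operations on bounds, with no decreasing sequence to be built.
The delicate one is the product, because the bounds of \<open>n q\<close> need not lie below a multiple
of \<open>1\<close>; \<open>order_converges_mult_null\<close> replaces truncation by the inequality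
\<open>b \<le> 1/\<epsilon> + \<epsilon> b\<^sup>2\<close>.

With \<open>z = j g\<close>, write the weight as \<open>((n choose k) / n\<^sup>k) (n q)\<^sup>k (1 - q)\<^bsup>n-k\<^esup>\<close>.  The real factor tends to
\<open>1/k!\<close> and \<open>(n q)\<^sup>k\<close> to \<open>z\<^sup>k\<close>.  In the last factor \<open>1 - q\<close> may be replaced by \<open>1 - z/n\<close> at a cost of
\<open>\<bar>n q - z\<bar>\<close>, and the exponent \<open>n - k\<close> by \<open>n\<close> at a cost of \<open>k z/n\<close>,
since powers of elements of \<open>[0, 1]\<close> satisfy \<open>\<bar>a\<^sup>n - b\<^sup>n\<bar> \<le> n \<bar>a - b\<bar>\<close>.  That
\<open>(1 - z/n)\<^sup>n\<close> converges to the inverse of \<open>exp z\<close> is \<open>exp_nonneg_inverse_limit\<close>; it is reduced to real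
numbers because \<open>0 \<le> z \<le> c\<close> and \<open>exp z - (1 + z/n)\<^sup>n\<close> is a power series with nonnegative
coefficients.

The pullback rests on \<open>j_range_ideal\<close>: a Dedekind complete order dense subspace is an
ideal.  Hence the limit, which lies in \<open>[0, 1] = [0, j e]\<close>, has a preimage \<open>h\<close>, and bounds found in
the completion can be cut off at \<open>j e\<close> and so become bounds in the original space.\<close>

section \<open>Order convergence through eventual bounds\<close>

text \<open>If the multiples \<open>n w\<close> have a common upper bound, their supremum \<open>s\<close> satisfies \<open>s \<le> s - w\<close>: Dedekind
completeness forces the Archimedean property.\<close>

lemma archimedean_nonpos:
  fixes w z :: "'a::dedekind_complete_riesz_space"
  assumes "\<And>\<epsilon>. 0 < \<epsilon> \<Longrightarrow> w \<le> \<epsilon> *\<^sub>R z"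
  shows "w \<le> 0"
proof -
  have mult: "real n *\<^sub>R w \<le> sup z 0" for n
  proof (cases "n = 0")
    case False
    then have "real n *\<^sub>R w \<le> real n *\<^sub>R ((1 / real n) *\<^sub>R z)"
      by (intro scaleR_left_mono assms) auto
    also have "\<dots> = z" using False by simp
    finally show ?thesis by (simp add: le_supI1)
  qed simp
  define s where "s = (SUP n. real n *\<^sub>R w)"
  have bdd: "bdd_above (range (\<lambda>n. real n *\<^sub>R w))"
    by (rule bdd_aboveI2[OF mult])
  have "s \<le> s - w"
    unfolding s_def
  proof (rule cSUP_least)
    fix n :: nat
    have "real (Suc n) *\<^sub>R w \<le> (SUP n. real n *\<^sub>R w)"
      by (rule cSUP_upper[OF _ bdd]) simp
    then show "real n *\<^sub>R w \<le> (SUP n. real n *\<^sub>R w) - w"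
      by (simp add: algebra_simps)
  qed simp
  then show ?thesis by (simp add: algebra_simps)
qed

lemma abs_scaleR:
  fixes x :: "'a::riesz_space"
  shows "\<bar>r *\<^sub>R x\<bar> = \<bar>r\<bar> *\<^sub>R \<bar>x\<bar>"
proof (rule antisym)
  have le: "\<bar>r *\<^sub>R x\<bar> \<le> \<bar>r\<bar> *\<^sub>R \<bar>x\<bar>" for r and x :: 'a
  proof (rule abs_leI)
    have *: "s *\<^sub>R x \<le> \<bar>r\<bar> *\<^sub>R \<bar>x\<bar>" if "s = r \<or> s = - r" for s
    proof (cases "0 \<le> s")
      case True
      then show ?thesis using that scaleR_left_mono[OF abs_ge_self[of x]] by fastforce
    next
      case False
      then show ?thesis
        using that scaleR_left_mono[OF abs_ge_minus_self[of x], of "- s"] by fastforce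
    qed
    show "r *\<^sub>R x \<le> \<bar>r\<bar> *\<^sub>R \<bar>x\<bar>" "- (r *\<^sub>R x) \<le> \<bar>r\<bar> *\<^sub>R \<bar>x\<bar>"
      using *[of r] *[of "- r"] by simp_all
  qed
  show "\<bar>r *\<^sub>R x\<bar> \<le> \<bar>r\<bar> *\<^sub>R \<bar>x\<bar>" by (rule le)
  show "\<bar>r\<bar> *\<^sub>R \<bar>x\<bar> \<le> \<bar>r *\<^sub>R x\<bar>"
  proof (cases "r = 0")
    case False
    have "\<bar>r\<bar> *\<^sub>R \<bar>inverse r *\<^sub>R (r *\<^sub>R x)\<bar> \<le> \<bar>r\<bar> *\<^sub>R (\<bar>inverse r\<bar> *\<^sub>R \<bar>r *\<^sub>R x\<bar>)"
      by (intro scaleR_left_mono le) simp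
    then show ?thesis using False by simp
  qed simp
qed

text \<open>The definition asks for a decreasing majorant.  From right to left, the tail suprema of
\<open>\<bar>x\<^sub>n - l\<bar>\<close> serve as one: they exist by Dedekind completeness and lie eventually below every
eventual bound.\<close>

lemma order_converges_iff_eventual_bounds:
  fixes x :: "nat \<Rightarrow> 'a::dedekind_complete_riesz_space"
  shows "order_converges x l \<longleftrightarrow>
    (\<forall>w. (\<forall>d. (\<forall>\<^sub>F n in sequentially. \<bar>x n - l\<bar> \<le> d) \<longrightarrow> w \<le> d) \<longrightarrow> w \<le> 0)"
    (is "_ \<longleftrightarrow> (\<forall>w. ?below w \<longrightarrow> w \<le> 0)")
proof
  assume "order_converges x l"
  then obtain u where u: "decseq u" "(INF n. u n) = 0" "\<And>n. \<bar>x n - l\<bar> \<le> u n"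
    unfolding order_converges_def by blast
  show "\<forall>w. ?below w \<longrightarrow> w \<le> 0"
  proof (intro allI impI)
    fix w assume w: "?below w"
    have "w \<le> u m" for m
    proof -
      have "\<bar>x n - l\<bar> \<le> u m" if "m \<le> n" for n
        using u(3)[of n] decseqD[OF u(1) that] by (rule order_trans)
      then have "\<forall>\<^sub>F n in sequentially. \<bar>x n - l\<bar> \<le> u m"
        by (auto simp: eventually_sequentially)
      then show ?thesis using w by blast
    qed
    then have "w \<le> (INF n. u n)" by (intro cINF_greatest) auto
    then show "w \<le> 0" using u by simp
  qed
next
  assume R: "\<forall>w. ?below w \<longrightarrow> w \<le> 0"
  obtain d0 where "\<forall>\<^sub>F n in sequentially. \<bar>x n - l\<bar> \<le> d0"
  proof (cases "\<exists>d. \<forall>\<^sub>F n in sequentially. \<bar>x n - l\<bar> \<le> d")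
    case False
    then have "\<forall>w :: 'a. w \<le> 0" using R by blast
    then show ?thesis by (intro that[of 0]) simp
  qed (use that in blast)
  then obtain N where N: "\<And>n. N \<le> n \<Longrightarrow> \<bar>x n - l\<bar> \<le> d0"
    by (auto simp: eventually_sequentially)
  have d0: "0 \<le> d0" using N[of N] abs_ge_zero order_trans by blast
  have all: "\<bar>x n - l\<bar> \<le> d0 + (\<Sum>m<N. \<bar>x m - l\<bar>)" for n
  proof (cases "N \<le> n")
    case True
    then show ?thesis using N[OF True] by (intro add_increasing2) (auto intro: sum_nonneg)
  next
    case False
    then have "\<bar>x n - l\<bar> \<le> (\<Sum>m<N. \<bar>x m - l\<bar>)"
      using sum_mono2[of "{..<N}" "{n}" "\<lambda>m. \<bar>x m - l\<bar>"] by auto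
    then show ?thesis using d0 by (intro add_increasing) auto
  qed
  define u where "u n = (SUP m\<in>{n..}. \<bar>x m - l\<bar>)" for n
  have bdd: "bdd_above ((\<lambda>m. \<bar>x m - l\<bar>) ` A)" for A
    using all by (auto intro!: bdd_aboveI2)
  have ge: "\<bar>x n - l\<bar> \<le> u n" for n
    unfolding u_def by (rule cSUP_upper[OF _ bdd]) simp
  have nn: "0 \<le> u n" for n using ge[of n] abs_ge_zero order_trans by blast
  have "decseq u"
    unfolding decseq_def u_def by (auto intro!: cSUP_subset_mono bdd)
  moreover have "(INF n. u n) = 0"
  proof (rule antisym)
    have "(INF n. u n) \<le> d" if "\<forall>\<^sub>F n in sequentially. \<bar>x n - l\<bar> \<le> d" for d
    proof -
      obtain M where M: "\<And>n. M \<le> n \<Longrightarrow> \<bar>x n - l\<bar> \<le> d"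
        using \<open>\<forall>\<^sub>F n in sequentially. \<bar>x n - l\<bar> \<le> d\<close> by (auto simp: eventually_sequentially)
      have "(INF n. u n) \<le> u M" by (rule cINF_lower[OF bdd_belowI2[OF nn]]) simp
      also have "u M \<le> d" unfolding u_def using M by (intro cSUP_least) auto
      finally show ?thesis .
    qed
    then show "(INF n. u n) \<le> 0" using R by blast
    show "0 \<le> (INF n. u n)" using nn by (intro cINF_greatest) auto
  qed
  ultimately show "order_converges x l" unfolding order_converges_def using ge by blast
qed

lemma order_convergesI:
  fixes x :: "nat \<Rightarrow> 'a::dedekind_complete_riesz_space"
  assumes "\<And>w. (\<And>d. \<forall>\<^sub>F n in sequentially. \<bar>x n - l\<bar> \<le> d \<Longrightarrow> w \<le> d) \<Longrightarrow> w \<le> 0"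
  shows "order_converges x l"
  using assms order_converges_iff_eventual_bounds by blast

lemma order_convergesD:
  fixes x :: "nat \<Rightarrow> 'a::dedekind_complete_riesz_space"
  assumes "order_converges x l"
    and "\<And>d. \<forall>\<^sub>F n in sequentially. \<bar>x n - l\<bar> \<le> d \<Longrightarrow> w \<le> d"
  shows "w \<le> 0"
  using assms order_converges_iff_eventual_bounds by blast

lemma order_converges_eventually_bounded:
  fixes x :: "nat \<Rightarrow> 'a::dedekind_complete_riesz_space"
  assumes "order_converges x l"
  obtains d where "\<forall>\<^sub>F n in sequentially. \<bar>x n - l\<bar> \<le> d"
proof -
  obtain u where "decseq u" and u: "\<And>n. \<bar>x n - l\<bar> \<le> u n"
    using assms unfolding order_converges_def by blast
  then have "\<bar>x n - l\<bar> \<le> u 0" for n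
    using order_trans[OF u decseqD[of u 0 n]] by simp
  then show ?thesis using that[of "u 0"] by simp
qed

lemma order_converges_squeeze:
  fixes x z :: "nat \<Rightarrow> 'a::dedekind_complete_riesz_space"
  assumes z: "order_converges z 0"
    and le: "\<forall>\<^sub>F n in sequentially. \<bar>x n - l\<bar> \<le> \<bar>z n\<bar>"
  shows "order_converges x l"
proof (rule order_convergesI)
  fix w assume w: "\<And>d. \<forall>\<^sub>F n in sequentially. \<bar>x n - l\<bar> \<le> d \<Longrightarrow> w \<le> d"
  show "w \<le> 0"
  proof (rule order_convergesD[OF z])
    fix d assume "\<forall>\<^sub>F n in sequentially. \<bar>z n - 0\<bar> \<le> d"
    with le have "\<forall>\<^sub>F n in sequentially. \<bar>x n - l\<bar> \<le> d"
      by eventually_elim (simp add: order_trans)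
    then show "w \<le> d" by (rule w)
  qed
qed

lemma order_converges_iff_diff_null:
  "order_converges x l \<longleftrightarrow> order_converges (\<lambda>n. x n - l) 0"
  unfolding order_converges_def by simp

text \<open>If \<open>c\<close> and \<open>d\<close> are eventual bounds for the two sequences, then \<open>c + d\<close> is one for the sum.  A
lower bound \<open>w\<close> of all these sums is removed from one family at a time.\<close>

lemma order_converges_add:
  fixes x y :: "nat \<Rightarrow> 'a::dedekind_complete_riesz_space"
  assumes x: "order_converges x l" and y: "order_converges y m"
  shows "order_converges (\<lambda>n. x n + y n) (l + m)"
proof (rule order_convergesI)
  fix w assume w: "\<And>d. \<forall>\<^sub>F n in sequentially. \<bar>x n + y n - (l + m)\<bar> \<le> d \<Longrightarrow> w \<le> d"
  show "w \<le> 0"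
  proof (rule order_convergesD[OF y])
    fix c assume c: "\<forall>\<^sub>F n in sequentially. \<bar>y n - m\<bar> \<le> c"
    have "w - c \<le> 0"
    proof (rule order_convergesD[OF x])
      fix d assume "\<forall>\<^sub>F n in sequentially. \<bar>x n - l\<bar> \<le> d"
      with c have "\<forall>\<^sub>F n in sequentially. \<bar>x n + y n - (l + m)\<bar> \<le> d + c"
      proof eventually_elim
        case (elim n)
        have "\<bar>x n + y n - (l + m)\<bar> \<le> \<bar>x n - l\<bar> + \<bar>y n - m\<bar>"
          using abs_triangle_ineq[of "x n - l" "y n - m"] by (simp add: algebra_simps)
        also have "\<dots> \<le> d + c" using elim by (intro add_mono)
        finally show ?case .
      qed
      then show "w - c \<le> d" using w[of "d + c"] by (simp add: algebra_simps)
    qed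
    then show "w \<le> c" by simp
  qed
qed

lemma order_converges_scaleR_null:
  fixes z :: "'a::dedekind_complete_riesz_space"
  assumes "r \<longlonglongrightarrow> (0::real)"
  shows "order_converges (\<lambda>n. r n *\<^sub>R z) 0"
proof (rule order_convergesI)
  fix w assume w: "\<And>d. \<forall>\<^sub>F n in sequentially. \<bar>r n *\<^sub>R z - 0\<bar> \<le> d \<Longrightarrow> w \<le> d"
  show "w \<le> 0"
  proof (rule archimedean_nonpos)
    fix \<epsilon> :: real assume "0 < \<epsilon>"
    then have "\<forall>\<^sub>F n in sequentially. \<bar>r n\<bar> < \<epsilon>"
      using assms by (auto simp: tendsto_iff dist_real_def)
    then have "\<forall>\<^sub>F n in sequentially. \<bar>r n *\<^sub>R z - 0\<bar> \<le> \<epsilon> *\<^sub>R \<bar>z\<bar>"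
    proof eventually_elim
      case (elim n)
      have "\<bar>r n\<bar> *\<^sub>R \<bar>z\<bar> \<le> \<epsilon> *\<^sub>R \<bar>z\<bar>" using elim by (intro scaleR_right_mono) auto
      then show ?case by (simp add: abs_scaleR)
    qed
    then show "w \<le> \<epsilon> *\<^sub>R \<bar>z\<bar>" by (rule w)
  qed
qed

lemma order_converges_const: "order_converges (\<lambda>n. l :: 'a::dedekind_complete_riesz_space) l"
  using order_converges_scaleR_null[of "\<lambda>_. 0" l] order_converges_iff_diff_null[of "\<lambda>_. l" l] by simp

lemma order_converges_le:
  fixes x :: "nat \<Rightarrow> 'a::dedekind_complete_riesz_space"
  assumes x: "order_converges x l" and le: "\<forall>\<^sub>F n in sequentially. x n \<le> b"
  shows "l \<le> b"
proof -
  have "l - b \<le> 0"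
  proof (rule order_convergesD[OF x])
    fix d assume "\<forall>\<^sub>F n in sequentially. \<bar>x n - l\<bar> \<le> d"
    with le have "\<forall>\<^sub>F n in sequentially. l - b \<le> d"
    proof eventually_elim
      case (elim n)
      have "l - b \<le> - (x n - l)" using elim(1) by (simp add: algebra_simps)
      also have "\<dots> \<le> \<bar>x n - l\<bar>" by (rule abs_ge_minus_self)
      also have "\<dots> \<le> d" by (rule elim)
      finally show ?case .
    qed
    then show "l - b \<le> d" by simp
  qed
  then show ?thesis by simp
qed

lemma order_converges_minus:
  "order_converges x l \<Longrightarrow> order_converges (\<lambda>n. - x n) (- l)"
  unfolding order_converges_def by (simp add: abs_minus_commute)

lemma order_converges_ge:
  fixes x :: "nat \<Rightarrow> 'a::dedekind_complete_riesz_space"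
  assumes "order_converges x l" and "\<forall>\<^sub>F n in sequentially. b \<le> x n"
  shows "b \<le> l"
  using order_converges_le[OF order_converges_minus[OF assms(1)], of "- b"] assms(2) by simp

lemma order_converges_unique:
  fixes x :: "nat \<Rightarrow> 'a::dedekind_complete_riesz_space"
  assumes "order_converges x l" and "order_converges x m"
  shows "l = m"
proof -
  have "order_converges (\<lambda>n. x n + - x n) (l + - m)"
    by (intro order_converges_add order_converges_minus assms)
  then have "order_converges (\<lambda>n. 0) (l - m)" by simp
  then have "l - m \<le> 0" "0 \<le> l - m"
    using order_converges_le[of "\<lambda>n. 0" "l - m" 0] order_converges_ge[of "\<lambda>n. 0" "l - m" 0]
    by simp_all
  then show ?thesis by simp
qed

lemma order_converges_cong:
  fixes x y :: "nat \<Rightarrow> 'a::dedekind_complete_riesz_space"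
  assumes "order_converges x l" and "\<forall>\<^sub>F n in sequentially. x n = y n"
  shows "order_converges y l"
proof (rule order_converges_squeeze)
  show "order_converges (\<lambda>n. x n - l) 0" using assms(1) order_converges_iff_diff_null by blast
  show "\<forall>\<^sub>F n in sequentially. \<bar>y n - l\<bar> \<le> \<bar>x n - l\<bar>"
    using assms(2) by eventually_elim simp
qed

section \<open>Order limits in f-algebras\<close>

text \<open>The positive and negative parts of an element are disjoint, and in an f-algebra disjoint
elements multiply to \<open>0\<close>, so the mixed terms of the square vanish.\<close>

lemma f_algebra_square_nonneg:
  fixes a :: "'u::unital_f_algebra"
  shows "0 \<le> a * a"
proof -
  define b c where "b = pprt a" and "c = - nprt a"
  have a: "a = b - c" and pos: "0 \<le> b" "0 \<le> c"
    unfolding b_def c_def using prts[of a] by auto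
  have "inf b c = 0"
  proof -
    have "inf b c + nprt a = inf (pprt a + nprt a) (- nprt a + nprt a)"
      unfolding b_def c_def by (rule add_inf_distrib_right)
    also have "\<dots> = inf a 0" using prts[of a] by simp
    finally show ?thesis by (simp add: nprt_def)
  qed
  then have "inf (c * b) c = 0" using f_algebra_inf[of b c c] pos by simp
  then have "inf c (c * b) = 0" by (simp add: inf_commute)
  then have "inf (b * c) (c * b) = 0" using f_algebra_inf[of c "c * b" b] pos by simp
  then have "b * c = 0" by (simp add: mult.commute)
  then have "a * a = b * b + c * c" unfolding a by (simp add: algebra_simps)
  then show ?thesis using pos by simp
qed

text \<open>Positivity of \<open>1\<close> is not an axiom, but \<open>1\<close> is a square.  The instance gives access to the
monotonicity rules for powers.\<close>

instance unital_f_algebra \<subseteq> ordered_semiring_1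
proof
  have "0 \<le> (1::'a)" using f_algebra_square_nonneg[of "1::'a"] by simp
  then show "0 < (1::'a)" by (simp add: less_le)
qed

lemma f_algebra_abs_mult_le:
  fixes a b c d :: "'u::unital_f_algebra"
  assumes "\<bar>a\<bar> \<le> c" "\<bar>b\<bar> \<le> d"
  shows "\<bar>a * b\<bar> \<le> c * d"
proof -
  have "\<bar>a * b\<bar> \<le> \<bar>a\<bar> * \<bar>b\<bar>" by (rule abs_le_mult)
  also have "\<dots> \<le> c * d"
    using assms by (intro mult_mono) (auto intro: order_trans[OF abs_ge_zero])
  finally show ?thesis .
qed

text \<open>An inequality that trades the unboundedness of \<open>b\<close> against a multiple of \<open>1\<close> with an error
that can be made small; it comes from \<open>0 \<le> \<epsilon> (b - 1/\<epsilon>)\<^sup>2 + b\<close>.\<close>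

lemma f_algebra_le_scale_add_square:
  fixes b :: "'u::unital_f_algebra"
  assumes "0 \<le> b" "0 < \<epsilon>"
  shows "b \<le> (1 / \<epsilon>) *\<^sub>R 1 + \<epsilon> *\<^sub>R (b * b)"
proof -
  have "0 \<le> \<epsilon> *\<^sub>R ((b - (1 / \<epsilon>) *\<^sub>R 1) * (b - (1 / \<epsilon>) *\<^sub>R 1)) + b"
    using assms by (intro add_nonneg_nonneg scaleR_nonneg_nonneg f_algebra_square_nonneg) auto
  also have "\<dots> = (1 / \<epsilon>) *\<^sub>R 1 + \<epsilon> *\<^sub>R (b * b) - b"
    using assms by (simp add: algebra_simps)
  finally show ?thesis by simp
qed

text \<open>For a bound \<open>d \<le> d0\<close> of \<open>\<bar>x\<^sub>n\<bar>\<close> the product is bounded by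
\<open>d b \<le> d/\<epsilon> + \<epsilon> b\<^sup>2 d0\<close>.  The infimum over \<open>d\<close> removes the first term, and then the
Archimedean property removes the second.\<close>

lemma order_converges_mult_null:
  fixes x y :: "nat \<Rightarrow> 'u::universally_complete_f_algebra"
  assumes x: "order_converges x 0" and b: "\<forall>\<^sub>F n in sequentially. \<bar>y n\<bar> \<le> b"
  shows "order_converges (\<lambda>n. x n * y n) 0"
proof (rule order_convergesI)
  fix w assume w: "\<And>d. \<forall>\<^sub>F n in sequentially. \<bar>x n * y n - 0\<bar> \<le> d \<Longrightarrow> w \<le> d"
  have b0: "0 \<le> b"
    using eventually_happens[OF b] order_trans[OF abs_ge_zero] by auto
  obtain d0 where d0: "\<forall>\<^sub>F n in sequentially. \<bar>x n - 0\<bar> \<le> d0"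
    using order_converges_eventually_bounded[OF x] by blast
  show "w \<le> 0"
  proof (rule archimedean_nonpos)
    fix \<epsilon> :: real assume eps: "0 < \<epsilon>"
    have "\<epsilon> *\<^sub>R (w - \<epsilon> *\<^sub>R (b * b * d0)) \<le> 0"
    proof (rule order_convergesD[OF x])
      fix d assume "\<forall>\<^sub>F n in sequentially. \<bar>x n - 0\<bar> \<le> d"
      with d0 have xd: "\<forall>\<^sub>F n in sequentially. \<bar>x n\<bar> \<le> inf d d0"
        by eventually_elim simp
      then obtain n where "\<bar>x n\<bar> \<le> inf d d0"
        using eventually_happens'[OF sequentially_bot] by blast
      then have nn: "0 \<le> inf d d0" by (rule order_trans[OF abs_ge_zero])
      from xd b have "\<forall>\<^sub>F n in sequentially. \<bar>x n * y n - 0\<bar> \<le> inf d d0 * b"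
        by eventually_elim (simp only: diff_0_right f_algebra_abs_mult_le)
      then have "w \<le> inf d d0 * b" by (rule w)
      also have "\<dots> \<le> inf d d0 * ((1 / \<epsilon>) *\<^sub>R 1 + \<epsilon> *\<^sub>R (b * b))"
        by (intro mult_left_mono f_algebra_le_scale_add_square b0 eps nn)
      also have "\<dots> = (1 / \<epsilon>) *\<^sub>R inf d d0 + \<epsilon> *\<^sub>R (b * b * inf d d0)"
        by (simp add: algebra_simps)
      also have "\<dots> \<le> (1 / \<epsilon>) *\<^sub>R d + \<epsilon> *\<^sub>R (b * b * d0)"
        using eps by (intro add_mono scaleR_left_mono mult_left_mono f_algebra_square_nonneg) auto
      finally have "w - \<epsilon> *\<^sub>R (b * b * d0) \<le> (1 / \<epsilon>) *\<^sub>R d" by (simp add: algebra_simps)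
      then have "\<epsilon> *\<^sub>R (w - \<epsilon> *\<^sub>R (b * b * d0)) \<le> \<epsilon> *\<^sub>R ((1 / \<epsilon>) *\<^sub>R d)"
        using eps by (intro scaleR_left_mono) auto
      then show "\<epsilon> *\<^sub>R (w - \<epsilon> *\<^sub>R (b * b * d0)) \<le> d" using eps by simp
    qed
    then have "w - \<epsilon> *\<^sub>R (b * b * d0) \<le> 0"
      using eps by (simp only: scaleR_le_0_iff) auto
    then show "w \<le> \<epsilon> *\<^sub>R (b * b * d0)" by simp
  qed
qed

lemma order_converges_mult:
  fixes x y :: "nat \<Rightarrow> 'u::universally_complete_f_algebra"
  assumes x: "order_converges x l" and y: "order_converges y m"
  shows "order_converges (\<lambda>n. x n * y n) (l * m)"
proof -
  obtain d where "\<forall>\<^sub>F n in sequentially. \<bar>y n - m\<bar> \<le> d"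
    using order_converges_eventually_bounded[OF y] by blast
  then have "\<forall>\<^sub>F n in sequentially. \<bar>y n\<bar> \<le> \<bar>m\<bar> + d"
  proof eventually_elim
    case (elim n)
    have "\<bar>y n\<bar> \<le> \<bar>m\<bar> + \<bar>y n - m\<bar>" using abs_triangle_ineq[of m "y n - m"] by simp
    also have "\<dots> \<le> \<bar>m\<bar> + d" using elim by simp
    finally show ?case .
  qed
  moreover have "order_converges (\<lambda>n. x n - l) 0" "order_converges (\<lambda>n. y n - m) 0"
    using x y order_converges_iff_diff_null by auto
  ultimately have "order_converges (\<lambda>n. (x n - l) * y n + (y n - m) * l) (0 + 0)"
    by (intro order_converges_add order_converges_mult_null[where b = "\<bar>m\<bar> + d"]
      order_converges_mult_null[where y = "\<lambda>_. l" and b = "\<bar>l\<bar>"]) auto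
  then have "order_converges (\<lambda>n. x n * y n - l * m) 0" by (simp add: algebra_simps)
  then show ?thesis by (subst order_converges_iff_diff_null)
qed

lemma order_converges_power:
  fixes x :: "nat \<Rightarrow> 'u::universally_complete_f_algebra"
  assumes "order_converges x l"
  shows "order_converges (\<lambda>n. x n ^ k) (l ^ k)"
  by (induction k) (auto intro: order_converges_mult assms order_converges_const)

lemma order_converges_of_real:
  assumes "r \<longlonglongrightarrow> c"
  shows "order_converges (\<lambda>n. of_real (r n)) (of_real c :: 'u::universally_complete_f_algebra)"
proof -
  have "(\<lambda>n. r n - c) \<longlonglongrightarrow> 0" using assms by (simp add: LIM_zero)
  from order_converges_scaleR_null[OF this, of "1::'u"] show ?thesis
    by (subst order_converges_iff_diff_null) (simp add: of_real_def algebra_simps)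
qed

lemma f_algebra_power_diff_le:
  fixes a b :: "'u::unital_f_algebra"
  assumes "0 \<le> a" "a \<le> 1" "0 \<le> b" "b \<le> 1"
  shows "\<bar>a ^ n - b ^ n\<bar> \<le> real n *\<^sub>R \<bar>a - b\<bar>"
proof (induction n)
  case (Suc n)
  have "a ^ Suc n - b ^ Suc n = a * (a ^ n - b ^ n) + (a - b) * b ^ n"
    by (simp add: algebra_simps)
  also have "\<bar>\<dots>\<bar> \<le> \<bar>a * (a ^ n - b ^ n)\<bar> + \<bar>(a - b) * b ^ n\<bar>"
    by (rule abs_triangle_ineq)
  also have "\<dots> \<le> 1 * (real n *\<^sub>R \<bar>a - b\<bar>) + \<bar>a - b\<bar> * 1"
    using assms Suc.IH
    by (intro add_mono f_algebra_abs_mult_le) (auto simp: power_le_one)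
  finally show ?case by (simp add: algebra_simps)
qed simp

section \<open>The exponential as a limit of powers\<close>

lemma binomial_over_power_le:
  "real (n choose k) / real n ^ k \<le> 1 / fact k"
proof (cases "n = 0")
  case False
  have "real ((n choose k) * fact k) \<le> real (n ^ k)"
    using binomial_fact_pow[of n k] by (simp only: of_nat_le_iff)
  then show ?thesis using False by (simp add: field_simps)
qed (cases k; simp)

lemma binomial_over_power_tendsto:
  "(\<lambda>n. real (n choose k) / real n ^ k) \<longlonglongrightarrow> 1 / fact k"
proof (induction k)
  case 0
  show ?case by simp
next
  case (Suc k)
  have "(\<lambda>n. 1 - real k * (1 / real n)) \<longlonglongrightarrow> 1 - real k * 0"
    by (intro tendsto_intros lim_1_over_n)
  then have "(\<lambda>n. (real (n choose k) / real n ^ k) * (1 - real k * (1 / real n)) / real (Suc k))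
    \<longlonglongrightarrow> (1 / fact k) * 1 / real (Suc k)"
    by (intro tendsto_intros Suc) simp_all
  moreover have "\<forall>\<^sub>F n in sequentially.
    (real (n choose k) / real n ^ k) * (1 - real k * (1 / real n)) / real (Suc k)
    = real (n choose Suc k) / real n ^ Suc k"
    using eventually_ge_at_top[of "Suc k"]
  proof eventually_elim
    case (elim n)
    have "Suc k * (n choose Suc k) = (n - k) * (n choose k)"
      using binomial_absorb_comp[of n k] binomial_absorption[of k n] by simp
    then have "real (Suc k) * real (n choose Suc k) = (real n - real k) * real (n choose k)"
      using elim by (simp only: of_nat_mult[symmetric] of_nat_diff[symmetric])
    then have "real (n choose Suc k) = (real n - real k) * real (n choose k) / real (Suc k)"
      by (subst nonzero_eq_divide_eq) (simp_all add: mult.commute)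
    moreover have "1 - real k * (1 / real n) = (real n - real k) / real n"
      using elim by (simp add: diff_divide_distrib)
    ultimately show ?case by (simp add: mult.commute)
  qed
  ultimately show ?case
    by (simp add: Lim_transform_eventually field_simps)
qed

lemma power_scaled:
  fixes z :: "'a::real_algebra_1"
  shows "(r *\<^sub>R z) ^ k = r ^ k *\<^sub>R z ^ k"
  by (induction k) simp_all

lemma of_nat_mult_eq_scaleR:
  fixes z :: "'a::real_algebra_1"
  shows "of_nat m * z = real m *\<^sub>R z"
  by (simp add: scaleR_conv_of_real)

text \<open>The summands with \<open>k > n\<close> vanish.  The free upper limit allows the power to be compared term
by term with every long enough partial sum of the exponential series.\<close>

lemma one_plus_scaled_power:
  fixes z :: "'u::unital_f_algebra"
  assumes "n \<le> N"
  shows "(1 + (1 / real n) *\<^sub>R z) ^ n = (\<Sum>k\<le>N. (real (n choose k) / real n ^ k) *\<^sub>R z ^ k)"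
proof -
  have "(1 + (1 / real n) *\<^sub>R z) ^ n = ((1 / real n) *\<^sub>R z + 1) ^ n"
    by (simp add: add.commute)
  also have "\<dots> = (\<Sum>k\<le>n. of_nat (n choose k) * ((1 / real n) *\<^sub>R z) ^ k * 1 ^ (n - k))"
    by (rule binomial_ring)
  also have "\<dots> = (\<Sum>k\<le>n. (real (n choose k) / real n ^ k) *\<^sub>R z ^ k)"
    by (intro sum.cong refl)
      (simp only: power_scaled of_nat_mult_eq_scaleR power_one mult_1_right scaleR_scaleR
        mult_scaleR_right power_one_over times_divide_eq_left mult_1_left)
  also have "\<dots> = (\<Sum>k\<le>N. (real (n choose k) / real n ^ k) *\<^sub>R z ^ k)"
    using assms by (intro sum.mono_neutral_left) auto
  finally show ?thesis .
qed

lemma power_le_scaled_one: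
  fixes z :: "'u::unital_f_algebra"
  assumes "0 \<le> z" "z \<le> c *\<^sub>R 1"
  shows "z ^ k \<le> c ^ k *\<^sub>R 1"
  using power_mono[OF assms(2,1), of k] by (simp add: power_scaled)

text \<open>The coefficients \<open>1/k! - (n choose k) / n\<^sup>k\<close> of the difference are nonnegative, so replacing
\<open>z\<^sup>k\<close> by \<open>c\<^sup>k\<close> only increases it.  The error is therefore the one made at the real number \<open>c\<close>.\<close>

lemma exp_nonneg_approx:
  fixes z :: "'u::universally_complete_f_algebra"
  assumes c: "0 \<le> c" and z: "0 \<le> z" "z \<le> c *\<^sub>R 1"
  shows "\<bar>exp_nonneg z - (1 + (1 / real n) *\<^sub>R z) ^ n\<bar> \<le> (exp c - (1 + c / real n) ^ n) *\<^sub>R 1"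
proof -
  define s where "s N = (\<Sum>k\<le>N. (1 / fact k) *\<^sub>R z ^ k)" for N
  define a where "a = (1 + (1 / real n) *\<^sub>R z) ^ n"
  define \<alpha> where "\<alpha> = exp c - (1 + c / real n) ^ n"
  have zk: "0 \<le> z ^ k" for k using z by simp
  have s_mono: "s M \<le> s N" if "M \<le> N" for M N
    unfolding s_def using that zk by (intro sum_mono2) (auto intro: scaleR_nonneg_nonneg)
  have diff: "s N - a = (\<Sum>k\<le>N. (1 / fact k - real (n choose k) / real n ^ k) *\<^sub>R z ^ k)"
    if "n \<le> N" for N
    unfolding s_def a_def one_plus_scaled_power[OF that]
    by (simp add: sum_subtractf scaleR_left_diff_distrib)
  have lower: "a \<le> s n"
  proof -
    have "0 \<le> s n - a" unfolding diff[OF order_refl]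
      using zk binomial_over_power_le by (intro sum_nonneg scaleR_nonneg_nonneg) auto
    then show ?thesis by simp
  qed
  have upper: "s N \<le> a + \<alpha> *\<^sub>R 1" for N
  proof -
    \<comment> \<open>Partial sums increase, so it suffices to treat one with at least \<open>n\<close> terms.\<close>
    define M where "M = max n N"
    have M: "n \<le> M" "N \<le> M" by (auto simp: M_def)
    have "(\<Sum>k\<le>M. (1 / fact k) * c ^ k) \<le> exp c"
    proof -
      have "(\<lambda>k. (1 / fact k) * c ^ k) sums exp c"
        using exp_converges[of c] by (simp add: divide_inverse)
      then show ?thesis using c
        by (intro order_trans[OF sum_le_suminf[of _ "{..M}"]]) (auto simp: sums_iff)
    qed
    moreover have "(\<Sum>k\<le>M. real (n choose k) / real n ^ k * c ^ k) = (1 + c / real n) ^ n"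
    proof -
      have "(c / real n + 1) ^ n = (\<Sum>k\<le>n. of_nat (n choose k) * (c / real n) ^ k * 1 ^ (n - k))"
        by (rule binomial_ring)
      also have "\<dots> = (\<Sum>k\<le>M. real (n choose k) / real n ^ k * c ^ k)"
        using M by (intro sum.mono_neutral_cong_left) (auto simp: power_divide)
      finally show ?thesis by (simp add: add.commute)
    qed
    ultimately have real: "(\<Sum>k\<le>M. (1 / fact k - real (n choose k) / real n ^ k) * c ^ k) \<le> \<alpha>"
      unfolding \<alpha>_def by (simp add: left_diff_distrib sum_subtractf)
    have "s M - a \<le> (\<Sum>k\<le>M. (1 / fact k - real (n choose k) / real n ^ k) *\<^sub>R (c ^ k *\<^sub>R 1))"
      unfolding diff[OF M(1)] using binomial_over_power_le z
      by (intro sum_mono scaleR_left_mono power_le_scaled_one) auto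
    also have "\<dots> = (\<Sum>k\<le>M. (1 / fact k - real (n choose k) / real n ^ k) * c ^ k) *\<^sub>R 1"
      by (simp add: scaleR_sum_left)
    also have "\<dots> \<le> \<alpha> *\<^sub>R 1" using real by (intro scaleR_right_mono) auto
    finally have "s M \<le> a + \<alpha> *\<^sub>R 1" by (simp add: algebra_simps)
    then show ?thesis using s_mono[OF M(2)] by (rule order_trans[rotated])
  qed
  have exp: "exp_nonneg z = (SUP N. s N)" unfolding exp_nonneg_def s_def ..
  have "s n \<le> exp_nonneg z" unfolding exp by (rule cSUP_upper[OF _ bdd_aboveI2[OF upper]]) simp
  with lower have "a \<le> exp_nonneg z" by (rule order_trans)
  moreover have "exp_nonneg z \<le> a + \<alpha> *\<^sub>R 1" unfolding exp using upper by (intro cSUP_least) auto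
  moreover have "a \<le> exp_nonneg z + \<alpha> *\<^sub>R 1"
  proof -
    have "a \<le> a + \<alpha> *\<^sub>R 1" using lower upper[of n] by (rule order_trans)
    then have "0 \<le> \<alpha> *\<^sub>R (1 :: 'u)" by simp
    with \<open>a \<le> exp_nonneg z\<close> show ?thesis by (intro add_increasing2)
  qed
  ultimately show ?thesis unfolding a_def[symmetric] \<alpha>_def[symmetric]
    by (intro abs_leI) (simp_all add: algebra_simps)
qed

text \<open>Let \<open>X = exp z\<close>, \<open>A = (1 + z/n)\<^sup>n\<close> and \<open>B = (1 - z/n)\<^sup>n\<close>.  Then \<open>A B = (1 - z\<^sup>2/n\<^sup>2)\<^sup>n\<close> differs from \<open>1\<close> by at
most \<open>c\<^sup>2/n\<close>, and \<open>A\<close> is close to \<open>X\<close>, so \<open>B\<close> is an approximate inverse of \<open>X\<close> with an error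
that is a real multiple \<open>\<delta>\<close> of \<open>1\<close>.  Approximate inverses are close to each other, hence the
sequence \<open>B\<close> is Cauchy with respect to \<open>1\<close> and its limit is an exact inverse.\<close>

lemma exp_nonneg_inverse_limit:
  fixes z :: "'u::universally_complete_f_algebra"
  assumes c: "0 \<le> c" and z: "0 \<le> z" "z \<le> c *\<^sub>R 1"
  obtains v where "exp_nonneg z * v = 1" "order_converges (\<lambda>n. (1 - (1 / real n) *\<^sub>R z) ^ n) v"
proof -
  define X where "X = exp_nonneg z"
  define A where "A n = (1 + (1 / real n) *\<^sub>R z) ^ n" for n
  define B where "B n = (1 - (1 / real n) *\<^sub>R z) ^ n" for n
  define \<delta> where "\<delta> n = exp c - (1 + c / real n) ^ n + c ^ 2 * (1 / real n)" for n
  \<comment> \<open>From \<open>N\<close> on, \<open>z / n\<close> lies between \<open>0\<close> and \<open>1\<close>.\<close>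
  define N where "N = Suc (nat \<lceil>c\<rceil>)"
  have N: "0 < n" "c \<le> real n" if "N \<le> n" for n
    using that unfolding N_def by linarith+
  have zn: "0 \<le> (1 / real n) *\<^sub>R z" "(1 / real n) *\<^sub>R z \<le> 1" if "N \<le> n" for n
  proof -
    show "0 \<le> (1 / real n) *\<^sub>R z" using z by (intro scaleR_nonneg_nonneg) auto
    have "(1 / real n) *\<^sub>R z \<le> (1 / real n) *\<^sub>R (c *\<^sub>R 1)" using z by (intro scaleR_left_mono) auto
    also have "\<dots> \<le> 1 *\<^sub>R 1" unfolding scaleR_scaleR
      using N[OF that] by (intro scaleR_right_mono) auto
    finally show "(1 / real n) *\<^sub>R z \<le> 1" by simp
  qed
  have B01: "0 \<le> B n" "B n \<le> 1" if "N \<le> n" for n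
    unfolding B_def using zn[OF that] by (auto intro!: power_le_one zero_le_power)
  have XB: "\<bar>X * B n - 1\<bar> \<le> \<delta> n *\<^sub>R 1" if n: "N \<le> n" for n
  proof -
    define y where "y = (1 / real n) *\<^sub>R z"
    have y: "0 \<le> y" "y \<le> 1" using zn[OF n] unfolding y_def by auto
    have yy: "0 \<le> y * y" "y * y \<le> 1" using y mult_mono[of y 1 y 1] by auto
    have "A n * B n = (1 - y * y) ^ n"
      unfolding A_def B_def y_def[symmetric] power_mult_distrib[symmetric]
      by (simp add: algebra_simps)
    then have "\<bar>A n * B n - 1\<bar> = \<bar>(1 - y * y) ^ n - 1 ^ n\<bar>" by simp
    also have "\<dots> \<le> real n *\<^sub>R \<bar>(1 - y * y) - 1\<bar>"
      using yy by (intro f_algebra_power_diff_le) auto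
    also have "\<dots> = (1 / real n) *\<^sub>R (z ^ 2)"
      using N[OF n] yy(1) unfolding y_def by (simp add: power2_eq_square)
    also have "\<dots> \<le> (1 / real n) *\<^sub>R (c ^ 2 *\<^sub>R 1)"
      by (intro scaleR_left_mono power_le_scaled_one z) auto
    finally have AB: "\<bar>A n * B n - 1\<bar> \<le> (c ^ 2 * (1 / real n)) *\<^sub>R 1" by (simp add: mult.commute)
    have "X * B n - 1 = (X - A n) * B n + (A n * B n - 1)" by (simp add: algebra_simps)
    also have "\<bar>\<dots>\<bar> \<le> \<bar>(X - A n) * B n\<bar> + \<bar>A n * B n - 1\<bar>" by (rule abs_triangle_ineq)
    also have "\<dots> \<le> (exp c - (1 + c / real n) ^ n) *\<^sub>R 1 * 1 + (c ^ 2 * (1 / real n)) *\<^sub>R 1"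
      using AB B01[OF n] unfolding X_def A_def
      by (intro add_mono f_algebra_abs_mult_le exp_nonneg_approx c z) auto
    also have "\<dots> = \<delta> n *\<^sub>R 1" unfolding \<delta>_def by (simp add: scaleR_left_distrib)
    finally show ?thesis .
  qed
  have cauchy: "B n - \<delta> n *\<^sub>R 1 \<le> B m + \<delta> m *\<^sub>R 1" if n: "N \<le> n" and m: "N \<le> m" for n m
  proof -
    \<comment> \<open>Both products \<open>X * B n\<close> and \<open>X * B m\<close> are nearly \<open>1\<close>, and \<open>0 \<le> B \<le> 1\<close>.\<close>
    have "B n - B m = B m * (X * B n - 1) + B n * (- (X * B m - 1))" by (simp add: algebra_simps)
    also have "\<dots> \<le> \<bar>B m * (X * B n - 1)\<bar> + \<bar>B n * (- (X * B m - 1))\<bar>"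
      by (intro add_mono abs_ge_self)
    also have "\<dots> \<le> 1 * (\<delta> n *\<^sub>R 1) + 1 * (\<delta> m *\<^sub>R 1)"
      using B01[OF n] B01[OF m] XB[OF n] XB[OF m]
      by (intro add_mono f_algebra_abs_mult_le) (simp_all only: abs_minus_cancel abs_of_nonneg)
    finally show ?thesis by (simp add: algebra_simps)
  qed
  \<comment> \<open>Every \<open>B n - \<delta> n\<close> is below every \<open>B m + \<delta> m\<close>, so the supremum lies in all these intervals.\<close>
  define v where "v = (SUP n\<in>{N..}. B n - \<delta> n *\<^sub>R 1)"
  have Bv: "\<bar>B n - v\<bar> \<le> \<delta> n *\<^sub>R 1" if n: "N \<le> n" for n
  proof -
    have "B n - \<delta> n *\<^sub>R 1 \<le> v" unfolding v_def
      by (rule cSUP_upper[OF _ bdd_aboveI2[where M = "B N + \<delta> N *\<^sub>R 1"]])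
        (use n cauchy[of _ N] in auto)
    moreover have "v \<le> B n + \<delta> n *\<^sub>R 1" unfolding v_def
      using cauchy[OF _ n] by (intro cSUP_least) auto
    ultimately show ?thesis by (intro abs_leI) (simp_all add: algebra_simps)
  qed
  have "\<delta> \<longlonglongrightarrow> exp c - exp c + c ^ 2 * 0" unfolding \<delta>_def
    by (intro tendsto_intros tendsto_exp_limit_sequentially lim_1_over_n)
  then have \<delta>: "order_converges (\<lambda>n. \<delta> n *\<^sub>R (1::'u)) 0"
    by (intro order_converges_scaleR_null) simp
  have ev: "\<forall>\<^sub>F n in sequentially. N \<le> n" by (rule eventually_ge_at_top)
  have lim: "order_converges B v"
  proof (rule order_converges_squeeze[OF \<delta>])
    show "\<forall>\<^sub>F n in sequentially. \<bar>B n - v\<bar> \<le> \<bar>\<delta> n *\<^sub>R 1\<bar>"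
      using ev by eventually_elim (rule order_trans[OF Bv abs_ge_self])
  qed
  have "order_converges (\<lambda>n. X * B n) 1"
  proof (rule order_converges_squeeze[OF \<delta>])
    show "\<forall>\<^sub>F n in sequentially. \<bar>X * B n - 1\<bar> \<le> \<bar>\<delta> n *\<^sub>R 1\<bar>"
      using ev by eventually_elim (rule order_trans[OF XB abs_ge_self])
  qed
  moreover have "order_converges (\<lambda>n. X * B n) (X * v)"
    by (intro order_converges_mult order_converges_const lim)
  ultimately have "X * v = 1" using order_converges_unique by blast
  then show ?thesis using that[of v] lim unfolding X_def B_def by simp
qed

text \<open>For \<open>- z \<le> 0\<close> the first factor of \<open>riesz_exp\<close> is the exponential of \<open>0\<close>, and inverses are unique
in a commutative ring.\<close>

lemma riesz_exp_uminus:
  fixes z v :: "'u::universally_complete_f_algebra"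
  assumes "0 \<le> z" and v: "exp_nonneg z * v = 1"
  shows "riesz_exp (- z) = v"
proof -
  have "(\<Sum>k\<le>n. (1 / fact k) *\<^sub>R (0::'u) ^ k) = 1" for n
    by (induction n) simp_all
  then have "exp_nonneg (0::'u) = 1" unfolding exp_nonneg_def by simp
  moreover have "(THE v. exp_nonneg z * v = 1) = v"
  proof (rule the_equality[where P = "\<lambda>v. exp_nonneg z * v = 1", OF v])
    fix w assume "exp_nonneg z * w = 1"
    then have "w = w * (exp_nonneg z * v)" using v by simp
    also have "\<dots> = v * (exp_nonneg z * w)" by (simp add: algebra_simps)
    finally show "w = v" using \<open>exp_nonneg z * w = 1\<close> by simp
  qed
  moreover have "pprt (- z) = 0" "nprt (- z) = - z" using assms(1) by auto
  ultimately show ?thesis unfolding riesz_exp_def by (simp only: minus_minus mult_1_left)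
qed

section \<open>The Poisson limit of binomial weights\<close>

text \<open>The factor \<open>(1 - q)\<^bsup>n-k\<^esup>\<close> is moved to \<open>(1 - z/n)\<^sup>n\<close> in two steps.  Replacing the base costs at
most \<open>n \<bar>q - z/n\<bar> = \<bar>n q - z\<bar>\<close>; raising the exponent by \<open>k\<close> costs at most \<open>k z/n\<close>.\<close>

lemma binomial_poisson_limit:
  fixes q :: "nat \<Rightarrow> 'u::universally_complete_f_algebra"
  assumes q: "\<And>n. 1 \<le> n \<Longrightarrow> 0 \<le> q n \<and> q n \<le> 1"
    and lim: "order_converges (\<lambda>n. real n *\<^sub>R q n) z"
    and c: "0 \<le> c" and z: "0 \<le> z" "z \<le> c *\<^sub>R 1"
  shows "order_converges (\<lambda>n. real (n choose k) *\<^sub>R (q n ^ k * (1 - q n) ^ (n - k)))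
    ((1 / fact k) *\<^sub>R (z ^ k * riesz_exp (- z)))"
proof -
  obtain v where v: "exp_nonneg z * v = 1"
    and Bv: "order_converges (\<lambda>n. (1 - (1 / real n) *\<^sub>R z) ^ n) v"
    using exp_nonneg_inverse_limit[OF c z] by metis
  have exp: "riesz_exp (- z) = v" by (rule riesz_exp_uminus[OF z(1) v])
  define y where "y n = (1 / real n) *\<^sub>R z" for n
  define N where "N = Suc (k + nat \<lceil>c\<rceil>)"
  have ev: "\<forall>\<^sub>F n in sequentially. N \<le> n" by (rule eventually_ge_at_top)
  have N: "0 < n" "c \<le> real n" "k \<le> n" if "N \<le> n" for n
    using that unfolding N_def by linarith+
  have y01: "0 \<le> y n" "y n \<le> 1" if "N \<le> n" for n
  proof -
    show "0 \<le> y n" unfolding y_def using z by (intro scaleR_nonneg_nonneg) auto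
    have "y n \<le> (1 / real n) *\<^sub>R (c *\<^sub>R 1)" unfolding y_def using z by (intro scaleR_left_mono) auto
    also have "\<dots> \<le> 1 *\<^sub>R 1" unfolding scaleR_scaleR
      using N[OF that] by (intro scaleR_right_mono) auto
    finally show "y n \<le> 1" by simp
  qed
  have change_base: "order_converges (\<lambda>n. (1 - q n) ^ (n - k) - (1 - y n) ^ (n - k)) 0"
  proof (rule order_converges_squeeze)
    show "order_converges (\<lambda>n. real n *\<^sub>R q n - z) 0"
      by (rule order_converges_iff_diff_null[THEN iffD1, OF lim])
    show "\<forall>\<^sub>F n in sequentially. \<bar>(1 - q n) ^ (n - k) - (1 - y n) ^ (n - k) - 0\<bar>
      \<le> \<bar>real n *\<^sub>R q n - z\<bar>"
      using ev
    proof eventually_elim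
      case (elim n)
      have "\<bar>(1 - q n) ^ (n - k) - (1 - y n) ^ (n - k)\<bar>
        \<le> real (n - k) *\<^sub>R \<bar>(1 - q n) - (1 - y n)\<bar>"
        using q[of n] y01[OF elim] N[OF elim] by (intro f_algebra_power_diff_le) auto
      also have "\<dots> \<le> real n *\<^sub>R \<bar>q n - y n\<bar>"
        by (intro scaleR_mono) (auto simp: abs_minus_commute)
      also have "\<dots> = \<bar>real n *\<^sub>R (q n - y n)\<bar>" by (simp add: abs_scaleR)
      also have "\<dots> = \<bar>real n *\<^sub>R q n - z\<bar>"
        using N[OF elim] by (simp add: y_def scaleR_right_diff_distrib)
      finally show ?case by simp
    qed
  qed
  have change_exponent: "order_converges (\<lambda>n. (1 - y n) ^ (n - k) - (1 - y n) ^ n) 0"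
  proof (rule order_converges_squeeze)
    have "(\<lambda>n. real k * (1 / real n)) \<longlonglongrightarrow> real k * 0"
      by (intro tendsto_intros lim_1_over_n)
    then show "order_converges (\<lambda>n. (real k * (1 / real n)) *\<^sub>R z) 0"
      by (intro order_converges_scaleR_null) simp
    show "\<forall>\<^sub>F n in sequentially. \<bar>(1 - y n) ^ (n - k) - (1 - y n) ^ n - 0\<bar>
      \<le> \<bar>(real k * (1 / real n)) *\<^sub>R z\<bar>"
      using ev
    proof eventually_elim
      case (elim n)
      have "(1 - y n) ^ n = (1 - y n) ^ (n - k) * (1 - y n) ^ k"
        using N[OF elim] by (simp add: power_add[symmetric])
      then have "(1 - y n) ^ (n - k) - (1 - y n) ^ n
        = (1 - y n) ^ (n - k) * (1 ^ k - (1 - y n) ^ k)" by (simp add: algebra_simps)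
      also have "\<bar>\<dots>\<bar> \<le> 1 * (real k *\<^sub>R \<bar>1 - (1 - y n)\<bar>)"
        using y01[OF elim]
        by (intro f_algebra_abs_mult_le f_algebra_power_diff_le) (auto simp: power_le_one)
      also have "\<dots> = \<bar>(real k * (1 / real n)) *\<^sub>R z\<bar>"
        using y01[OF elim] z(1) by (simp add: y_def abs_scaleR)
      finally show ?case by simp
    qed
  qed
  have failures: "order_converges (\<lambda>n. (1 - q n) ^ (n - k)) v"
    using order_converges_add[OF order_converges_add[OF change_base change_exponent] Bv]
    by (simp add: y_def)
  have "order_converges (\<lambda>n. of_real (real (n choose k) / real n ^ k) * (real n *\<^sub>R q n) ^ k
      * (1 - q n) ^ (n - k)) (of_real (1 / fact k) * z ^ k * v)"
    by (intro order_converges_mult order_converges_of_real order_converges_power failures lim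
      binomial_over_power_tendsto)
  moreover have "\<forall>\<^sub>F n in sequentially. of_real (real (n choose k) / real n ^ k)
      * (real n *\<^sub>R q n) ^ k * (1 - q n) ^ (n - k)
    = real (n choose k) *\<^sub>R (q n ^ k * (1 - q n) ^ (n - k))"
    using ev
  proof eventually_elim
    case (elim n)
    then show ?case using N[OF elim] by (simp add: power_scaled of_real_def)
  qed
  ultimately have "order_converges (\<lambda>n. real (n choose k) *\<^sub>R (q n ^ k * (1 - q n) ^ (n - k)))
    (of_real (1 / fact k) * z ^ k * v)" by (rule order_converges_cong)
  then show ?thesis by (simp add: exp of_real_def)
qed

text \<open>The weights are nonnegative and, by the binomial theorem, sum to \<open>(q + (1 - q))\<^sup>n = 1\<close>.\<close>

lemma binomial_weight_bounds:
  fixes q :: "'u::unital_f_algebra"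
  assumes q: "0 \<le> q" "q \<le> 1" and k: "k \<le> n"
  shows "0 \<le> real (n choose k) *\<^sub>R (q ^ k * (1 - q) ^ (n - k))"
    and "real (n choose k) *\<^sub>R (q ^ k * (1 - q) ^ (n - k)) \<le> 1"
proof -
  define t where "t i = real (n choose i) *\<^sub>R (q ^ i * (1 - q) ^ (n - i))" for i
  have nonneg: "0 \<le> t i" for i
    unfolding t_def using q by (intro scaleR_nonneg_nonneg mult_nonneg_nonneg zero_le_power) auto
  have "t k \<le> (\<Sum>i\<le>n. t i)" using nonneg k by (intro member_le_sum) auto
  also have "\<dots> = (q + (1 - q)) ^ n"
    unfolding binomial_ring t_def by (simp add: of_nat_mult_eq_scaleR)
  finally show "t k \<le> 1" by simp
  show "0 \<le> t k" by (rule nonneg)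
qed

section \<open>The embedding into the universal completion\<close>

text \<open>The elements bounded by a multiple of \<open>e\<close> form an order ideal, so they include the
generated one.\<close>

lemma order_ideal_hull_bounded:
  assumes "0 \<le> e" and "g \<in> order_ideal hull {e}"
  obtains c where "0 \<le> c" "\<bar>g\<bar> \<le> c *\<^sub>R e"
proof -
  define I where "I = {x. \<exists>c\<ge>0. \<bar>x\<bar> \<le> c *\<^sub>R e}"
  have "order_ideal I"
    unfolding order_ideal_def
  proof (intro conjI subspaceI ballI allI impI)
    show "0 \<in> I" unfolding I_def by (auto intro!: exI[of _ 0])
  next
    fix x y assume "x \<in> I" "y \<in> I"
    then obtain c d where "0 \<le> c" "0 \<le> d" "\<bar>x\<bar> \<le> c *\<^sub>R e" "\<bar>y\<bar> \<le> d *\<^sub>R e"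
      unfolding I_def by blast
    moreover from this have "\<bar>x + y\<bar> \<le> (c + d) *\<^sub>R e"
      unfolding scaleR_left_distrib by (intro order_trans[OF abs_triangle_ineq] add_mono)
    ultimately show "x + y \<in> I" unfolding I_def by (auto intro!: exI[of _ "c + d"])
  next
    fix r x assume "x \<in> I"
    then obtain c where "0 \<le> c" "\<bar>x\<bar> \<le> c *\<^sub>R e" unfolding I_def by blast
    moreover from this have "\<bar>r *\<^sub>R x\<bar> \<le> (\<bar>r\<bar> * c) *\<^sub>R e"
      using scaleR_left_mono[of "\<bar>x\<bar>" "c *\<^sub>R e" "\<bar>r\<bar>"] by (simp add: abs_scaleR)
    ultimately show "r *\<^sub>R x \<in> I" unfolding I_def by (auto intro!: exI[of _ "\<bar>r\<bar> * c"])
  next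
    fix y x assume "y \<in> I" "\<bar>x\<bar> \<le> \<bar>y\<bar>"
    then show "x \<in> I" unfolding I_def using order_trans by blast
  qed
  moreover have "{e} \<subseteq> I" using assms(1) unfolding I_def by (auto intro!: exI[of _ 1])
  ultimately have "g \<in> I" using assms(2) hull_minimal by blast
  then show ?thesis using that unfolding I_def by blast
qed

context universal_completion
begin

lemma j_le_iff: "j x \<le> j y \<longleftrightarrow> x \<le> y"
  using j_inf[of x y] injD[OF j_inj, of "inf x y" x] by (auto simp: le_iff_inf)

lemma j_abs: "j \<bar>x\<bar> = \<bar>j x\<bar>"
  by (simp add: abs_lattice j_sup linear_neg[OF j_linear])

lemma j_nonneg_iff: "0 \<le> j x \<longleftrightarrow> 0 \<le> x"
  using j_le_iff[of 0 x] linear_0[OF j_linear] by simp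

text \<open>The preimage of \<open>u\<close> is \<open>s = sup {a. j a \<le> u}\<close>.  If \<open>j s\<close> missed \<open>u\<close> from below or above, order
density would put some \<open>j x > 0\<close> into the gap, and then \<open>s - x\<close> would still be an upper bound.\<close>

lemma j_range_ideal:
  assumes u: "0 \<le> u" "u \<le> j b"
  obtains a where "j a = u"
proof
  define S where "S = {a. j a \<le> u}"
  define s where "s = Sup S"
  have bdd: "bdd_above S"
  proof (rule bdd_aboveI)
    fix a assume "a \<in> S"
    then have "j a \<le> j b" using u(2) unfolding S_def by (blast intro: order_trans)
    then show "a \<le> b" by (simp add: j_le_iff)
  qed
  have zero: "0 \<in> S" unfolding S_def using u(1) linear_0[OF j_linear] by simp
  have "u \<le> j s"
  proof (rule ccontr)
    assume "\<not> u \<le> j s"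
    then have "inf u (j s) \<noteq> u" by (metis inf.cobounded2)
    then have "inf u (j s) < u" by (simp add: less_le)
    then have "0 < u - inf u (j s)" by (simp only: diff_gt_0_iff_gt)
    then obtain x where x: "0 < j x" "j x \<le> u - inf u (j s)" using j_order_dense by blast
    have "a \<le> s - x" if "a \<in> S" for a
    proof -
      have "a \<le> s" unfolding s_def by (rule cSup_upper[OF that bdd])
      then have "j a \<le> inf u (j s)" using that j_le_iff unfolding S_def by simp
      then have "j a + j x \<le> inf u (j s) + (u - inf u (j s))" using x(2) by (rule add_mono)
      then have "j a + j x \<le> u"
        by (simp only: add.commute[of "inf u (j s)"] diff_add_cancel)
      then have "a + x \<in> S" unfolding S_def by (simp add: linear_add[OF j_linear])
      then have "a + x \<le> s" unfolding s_def by (rule cSup_upper[OF _ bdd])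
      then show ?thesis by (simp add: algebra_simps)
    qed
    then have "s \<le> s - x" unfolding s_def using zero by (intro cSup_least) auto
    then have "j x \<le> 0" using j_le_iff[of x 0] linear_0[OF j_linear] by simp
    then show False using x(1) by simp
  qed
  moreover have "j s \<le> u"
  proof (rule ccontr)
    assume "\<not> j s \<le> u"
    then have "0 < j s - u" using \<open>u \<le> j s\<close> by (simp add: less_le_not_le)
    then obtain x where x: "0 < j x" "j x \<le> j s - u" using j_order_dense by blast
    have "a \<le> s - x" if "a \<in> S" for a
    proof -
      have "j a \<le> u" using that unfolding S_def by simp
      also have "u \<le> j (s - x)" using x(2) by (simp add: linear_diff[OF j_linear] algebra_simps)
      finally show ?thesis by (simp add: j_le_iff)
    qed
    then have "s \<le> s - x" unfolding s_def using zero by (intro cSup_least) auto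
    then have "j x \<le> 0" using j_le_iff[of x 0] linear_0[OF j_linear] by simp
    then show False using x(1) by simp
  qed
  ultimately show "j s = u" by simp
qed

text \<open>Order density makes \<open>j\<close> order continuous: a positive lower bound of the images would dominate
some \<open>j a > 0\<close>, and \<open>a\<close> would be a lower bound in the original space.\<close>

lemma j_order_converges:
  assumes "order_converges x l"
  shows "order_converges (\<lambda>n. j (x n)) (j l)"
proof (rule order_convergesI)
  fix w assume w: "\<And>d. \<forall>\<^sub>F n in sequentially. \<bar>j (x n) - j l\<bar> \<le> d \<Longrightarrow> w \<le> d"
  show "w \<le> 0"
  proof (rule ccontr)
    assume "\<not> w \<le> 0"
    then have "0 < sup w 0" by (metis less_le sup.cobounded1 sup.cobounded2)
    then obtain a where a: "0 < j a" "j a \<le> sup w 0" using j_order_dense by blast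
    have "a \<le> 0"
    proof (rule order_convergesD[OF assms])
      fix d assume d: "\<forall>\<^sub>F n in sequentially. \<bar>x n - l\<bar> \<le> d"
      then have "\<forall>\<^sub>F n in sequentially. \<bar>j (x n) - j l\<bar> \<le> j d"
        by (simp add: linear_diff[OF j_linear, symmetric] j_abs[symmetric] j_le_iff)
      then have "w \<le> j d" by (rule w)
      moreover obtain n where "\<bar>x n - l\<bar> \<le> d"
        using d eventually_happens'[OF sequentially_bot] by blast
      then have "0 \<le> j d" using order_trans[OF abs_ge_zero] j_nonneg_iff by blast
      ultimately have "j a \<le> j d" using a(2) by (intro order_trans[OF a(2)]) simp
      then show "a \<le> d" by (simp add: j_le_iff)
    qed
    then show False using a(1) j_le_iff[of a 0] linear_0[OF j_linear] by simp
  qed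
qed

text \<open>Eventual bounds in the completion need not come from the original space.  Cut off at \<open>j b\<close>
they lie in the range of \<open>j\<close>, which is an ideal.\<close>

lemma order_converges_if_j_order_converges:
  assumes lim: "order_converges (\<lambda>n. j (x n)) (j l)"
    and bound: "\<forall>\<^sub>F n in sequentially. \<bar>x n - l\<bar> \<le> b"
  shows "order_converges x l"
proof (rule order_convergesI)
  fix w assume w: "\<And>d. \<forall>\<^sub>F n in sequentially. \<bar>x n - l\<bar> \<le> d \<Longrightarrow> w \<le> d"
  have "j w \<le> 0"
  proof (rule order_convergesD[OF lim])
    fix d assume "\<forall>\<^sub>F n in sequentially. \<bar>j (x n) - j l\<bar> \<le> d"
    with bound have ev: "\<forall>\<^sub>F n in sequentially. j \<bar>x n - l\<bar> \<le> inf d (j b)"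
      by eventually_elim (simp add: linear_diff[OF j_linear] j_abs j_le_iff[symmetric])
    then obtain n where "j \<bar>x n - l\<bar> \<le> inf d (j b)"
      using eventually_happens'[OF sequentially_bot] by blast
    then have "0 \<le> inf d (j b)" by (rule order_trans[rotated]) (simp add: j_nonneg_iff)
    then obtain a where a: "j a = inf d (j b)" using j_range_ideal[of "inf d (j b)" b] by auto
    then have "w \<le> a" using ev by (intro w) (simp add: j_le_iff flip: a)
    then have "j w \<le> inf d (j b)" by (simp add: j_le_iff flip: a)
    then show "j w \<le> d" by simp
  qed
  then show "w \<le> 0" using j_le_iff[of w 0] linear_0[OF j_linear] by simp
qed

end

section \<open>Convergence to the Poisson distribution\<close>

theorem theorem33:
  fixes e :: "'a::dedekind_complete_riesz_space"
    and T :: "'a \<Rightarrow> 'a"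
    and j :: "'a \<Rightarrow> 'u::universally_complete_f_algebra"
    and y p :: "nat \<Rightarrow> 'a"
    and g :: 'a
  assumes triple: "conditional_riesz_triple e T"
    and completion: "universal_completion e j"
    and natural: "\<And>n. n \<ge> 1 \<Longrightarrow> natural_element e T (y n)"
    and binomial: "\<And>n. n \<ge> 1 \<Longrightarrow> binomial_T_distribution e T j (y n) n (p n)"
    and np_converges: "order_converges (\<lambda>n. real n *\<^sub>R p n) g"
    and g_ideal: "g \<in> order_ideal hull {e}"
    and g_pos: "0 < g"
  shows "\<forall>k. \<exists>h. j h = (1 / fact k) *\<^sub>R (j g ^ k * riesz_exp (- j g)) \<and>
           order_converges (\<lambda>n. T_mass e T (y n) (real k)) h"
proof
  fix k
  interpret universal_completion e j by (rule completion)
  have scaleR: "j (r *\<^sub>R x) = r *\<^sub>R j x" for r x by (rule linear_scale[OF j_linear])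
  have "0 \<le> e" using triple unfolding conditional_riesz_triple_def weak_order_unit_def by blast
  then obtain c where c: "0 \<le> c" "g \<le> c *\<^sub>R e"
    using order_ideal_hull_bounded[OF _ g_ideal] g_pos by auto
  have z: "0 \<le> j g" "j g \<le> c *\<^sub>R 1"
    using g_pos c(2) j_le_iff[of g "c *\<^sub>R e"] by (auto simp: j_nonneg_iff scaleR j_unit)
  have q: "0 \<le> j (p n) \<and> j (p n) \<le> 1" if "1 \<le> n" for n
    using binomial[OF that] j_le_iff[of "p n" e]
    unfolding binomial_T_distribution_def by (auto simp: j_nonneg_iff j_unit)
  define t where "t n = real (n choose k) *\<^sub>R (j (p n) ^ k * (1 - j (p n)) ^ (n - k))" for n
  define L where "L = (1 / fact k) *\<^sub>R (j g ^ k * riesz_exp (- j g))"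
  have "order_converges (\<lambda>n. real n *\<^sub>R j (p n)) (j g)"
    using j_order_converges[OF np_converges] by (simp add: scaleR)
  then have t_lim: "order_converges t L"
    unfolding t_def L_def by (intro binomial_poisson_limit[OF q _ c(1) z])
  have ev: "\<forall>\<^sub>F n in sequentially. Suc k \<le> n" by (rule eventually_ge_at_top)
  have t01: "0 \<le> t n" "t n \<le> 1" if "Suc k \<le> n" for n
    unfolding t_def using q[of n] that binomial_weight_bounds[of "j (p n)" k n] by auto
  have mass: "j (T_mass e T (y n) (real k)) = t n" if "Suc k \<le> n" for n
    using binomial[of n] that unfolding binomial_T_distribution_def t_def
    by (simp add: linear_diff[OF j_linear] j_unit)
  have "0 \<le> L" by (rule order_converges_ge[OF t_lim]) (use ev in eventually_elim, rule t01)
  moreover have "L \<le> j e" unfolding j_unit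
    by (rule order_converges_le[OF t_lim]) (use ev in eventually_elim, rule t01)
  ultimately obtain h where h: "j h = L" by (rule j_range_ideal)
  have "order_converges (\<lambda>n. T_mass e T (y n) (real k)) h"
  proof (rule order_converges_if_j_order_converges)
    show "order_converges (\<lambda>n. j (T_mass e T (y n) (real k))) (j h)"
      unfolding h by (rule order_converges_cong[OF t_lim])
        (use ev in eventually_elim, simp add: mass)
    show "\<forall>\<^sub>F n in sequentially. \<bar>T_mass e T (y n) (real k) - h\<bar> \<le> e"
      using ev
    proof eventually_elim
      case (elim n)
      have "\<bar>t n - L\<bar> \<le> 1"
        using t01[OF elim] \<open>0 \<le> L\<close> \<open>L \<le> j e\<close> diff_mono[of "t n" 1 0 L] diff_mono[of L 1 0 "t n"]
        by (intro abs_leI) (auto simp: j_unit)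
      then have "j \<bar>T_mass e T (y n) (real k) - h\<bar> \<le> j e"
        by (simp add: j_abs linear_diff[OF j_linear] mass[OF elim] h j_unit)
      then show ?case by (simp add: j_le_iff)
    qed
  qed
  with h show "\<exists>h. j h = (1 / fact k) *\<^sub>R (j g ^ k * riesz_exp (- j g)) \<and>
    order_converges (\<lambda>n. T_mass e T (y n) (real k)) h"
    unfolding L_def by blast
qed

end
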